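(* Let $(X,f)$ and $(Y,g)$ be set-function pairs (with $f:X\times X\to\mathbb{R}$, $g:Y\times Y\to\mathbb{R}$ arbitrary functions) such that $d_{CD}((X,f),(Y,g))$ is finite, and let $k\ge 0$ be an integer. Let $P^X$ and $P^Y$ be the $k$-th dimensional directed Rips persistence modules of $(X,f)$ and $(Y,g)$, i.e. the $k$-th dimensional ordered tuple persistence modules of the directed Rips filtrations $\{\mathcal{R}^{dir}(X,f)_t\}$ and $\{\mathcal{R}^{dir}(Y,g)_t\}$. Then $$d_{int}(P^X,P^Y)\le 2\,d_{CD}((X,f),(Y,g)).$$
   Context: Fix a field $\mathbb{F}$. A set-function pair $(X,f)$ is a set $X$ with a function $f:X\times X\to\mathbb{R}$. A correspondence between $X$ and $Y$ is a subset $\mathcal{M}\subset X\times Y$ such that every $x\in X$ has some $y\in Y$ with $(x,y)\in\mathcal{M}$ and every $y\in Y$ has some $x\in X$ with $(x,y)\in\mathcal{M}$. Its distortion is $dis_{(X,f),(Y,g)}(\mathcal{M})=\sup_{(x_1,y_1),(x_2,y_2)\in\mathcal{M}}|f(x_1,x_2)-g(y_1,y_2)|$. The correspondence distortion distance is $d_{CD}((X,f),(Y,g))=\frac12\inf_{\mathcal{M}}dis_{(X,f),(Y,g)}(\mathcal{M})\in[0,\infty]$, the infimum over all correspondences between $X$ and $Y$. An ordered tuple is a finite sequence $(v_0,\dots,v_p)$, $p\ge0$, possibly with repeats. An ordered tuple complex (OT-complex) $K$ is a collection of ordered tuples such that if $(v_0,\dots,v_p)\in K$ (with $p\ge1$)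 then $(v_0,\dots,\hat{v_i},\dots,v_p)\in K$ for all $i$ ($v_i$ removed). Its chain complex has $C_p(K)$ the $\mathbb{F}$-vector space with basis the ordered tuples in $K$ of length $p+1$, boundary $\partial_p(v_0,\dots,v_p)=\sum_{i=0}^p(-1)^i(v_0,\dots,\hat{v_i},\dots,v_p)$ for $p\ge1$ and $\partial_0=0$, and homology $H_k(K)=\ker\partial_k/\operatorname{im}\partial_{k+1}$. A filtration of OT-complexes is a family $\{K_t\}_{t\in\mathbb{R}}$ with $K_t\subset K_r$ for $t\le r$; its $k$-th dimensional ordered tuple persistence module is $\{H_k(K_t)\}_{t\in\mathbb{R}}$ with the maps induced by inclusions. The directed Rips filtration of $(X,f)$: $(v_0,\dots,v_p)\in\mathcal{R}^{dir}(X,f)_t$ iff all $v_i\in X$ and $f(v_i,v_j)\le t$ for all $i\le j$ (including $i=j$), $t\in\mathbb{R}$. A persistence module is a family $\{P_t\}_{t\in\mathbb{R}}$ of $\mathbb{F}$-vector spaces with linear maps $\iota_t^s:P_t\to P_s$ for $t\le s$ such that $\iota_t^t=\mathrm{id}$ and $\iota_t^r=\iota_s^r\circ\iota_t^s$ for $t\le s\le r$. Persistence modules $P^X,P^Y$ are $\epsilon$-interleaved if there are families of linear maps $\alpha_t:P^X_t\to P^Y_{t+\epsilon}$ and $\beta_t:P^Y_t\to P^X_{t+\epsilon}$ ($t\in\mathbb{R}$) that commute with the structure maps ($\alpha_{t'}\circ\iota_t^{t'}=\iota_{t+\epsilon}^{t'+\epsilon}\circ\alpha_t$ and $\beta_{t'}\circ\iota_t^{t'}=\iota_{t+\epsilon}^{t'+\epsilon}\circ\beta_t$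 for $t\le t'$) and satisfy $\beta_{t+\epsilon}\circ\alpha_t=\iota_t^{t+2\epsilon}$ and $\alpha_{t+\epsilon}\circ\beta_t=\iota_t^{t+2\epsilon}$ for all $t$. The interleaving distance $d_{int}(P^X,P^Y)\in[0,\infty]$ is the infimum of all $\epsilon>0$ such that $P^X,P^Y$ are $\epsilon$-interleaved. *)

theory Defs
  imports
    "HOL-Algebra.QuotRing"
    "HOL-Algebra.Module"
    "HOL-Algebra.Algebraic_Closure_Type"
    "HOL-Library.Poly_Mapping"
    "HOL-Library.Extended_Nonnegative_Real"
begin

text \<open>The indexed notation \<open>X\<close> for the polynomial variable would capture free variables \<open>X\<close>.\<close>

no_notation Polynomials.var (\<open>X\<index>\<close>)

section \<open>Correspondence distortion distance\<close>

text \<open>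
  A set-function pair is given by a set \<open>X\<close> and a function \<open>f\<close>, whose values outside
  \<open>X \<times> X\<close> play no role. The supremum and infimum are taken in \<open>[0, \<infinity>]\<close>: the distortion of the
  empty correspondence (between empty sets) is \<open>0\<close>, and the distance is \<open>\<infinity>\<close> if there is no
  correspondence.
\<close>

definition correspondence :: "'a set \<Rightarrow> 'b set \<Rightarrow> ('a \<times> 'b) set \<Rightarrow> bool" where
  "correspondence X Y M \<longleftrightarrow> M \<subseteq> X \<times> Y \<and>
     (\<forall>x\<in>X. \<exists>y\<in>Y. (x, y) \<in> M) \<and> (\<forall>y\<in>Y. \<exists>x\<in>X. (x, y) \<in> M)"

definition distortion ::
    "('a \<Rightarrow> 'a \<Rightarrow> real) \<Rightarrow> ('b \<Rightarrow> 'b \<Rightarrow> real) \<Rightarrow> ('a \<times> 'b) set \<Rightarrow> ennreal" where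
  "distortion f g M =
     (SUP ((x1, y1), (x2, y2)) \<in> M \<times> M. ennreal \<bar>f x1 x2 - g y1 y2\<bar>)"

definition correspondence_distance ::
    "'a set \<Rightarrow> ('a \<Rightarrow> 'a \<Rightarrow> real) \<Rightarrow> 'b set \<Rightarrow> ('b \<Rightarrow> 'b \<Rightarrow> real) \<Rightarrow> ennreal" where
  "correspondence_distance X f Y g =
     (INF M \<in> {M. correspondence X Y M}. distortion f g M) / 2"


section \<open>Persistence modules and the interleaving distance\<close>

definition linear_maps :: "('f::field, 'v) module \<Rightarrow> ('f, 'w) module \<Rightarrow> ('v \<Rightarrow> 'w) set" where
  "linear_maps V W = {h. h \<in> carrier V \<rightarrow> carrier W \<and>
     (\<forall>x\<in>carrier V. \<forall>y\<in>carrier V. h (x \<oplus>\<^bsub>V\<^esub> y) = h x \<oplus>\<^bsub>W\<^esub> h y) \<and>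
     (\<forall>a. \<forall>x\<in>carrier V. h (a \<odot>\<^bsub>V\<^esub> x) = a \<odot>\<^bsub>W\<^esub> h x)}"

text \<open>\<open>pm_map P t s\<close> is the structure map from index \<open>t\<close> to index \<open>s\<close>; it is only relevant for
  \<open>t \<le> s\<close> and on the carrier of \<open>pm_space P t\<close>.\<close>

record ('f, 'v) persistence =
  pm_space :: "real \<Rightarrow> ('f, 'v) module"
  pm_map :: "real \<Rightarrow> real \<Rightarrow> 'v \<Rightarrow> 'v"

definition persistence_module :: "('f::field, 'v) persistence \<Rightarrow> bool" where
  "persistence_module P \<longleftrightarrow>
     (\<forall>t. module ring_of_type_algebra (pm_space P t)) \<and>
     (\<forall>t s. t \<le> s \<longrightarrow> pm_map P t s \<in> linear_maps (pm_space P t) (pm_space P s)) \<and>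
     (\<forall>t. \<forall>x\<in>carrier (pm_space P t). pm_map P t t x = x) \<and>
     (\<forall>t s r. t \<le> s \<longrightarrow> s \<le> r \<longrightarrow>
        (\<forall>x\<in>carrier (pm_space P t). pm_map P t r x = pm_map P s r (pm_map P t s x)))"

definition shift_morphism ::
    "real \<Rightarrow> ('f::field, 'v) persistence \<Rightarrow> ('f, 'w) persistence \<Rightarrow> (real \<Rightarrow> 'v \<Rightarrow> 'w) \<Rightarrow> bool" where
  "shift_morphism \<epsilon> P Q \<alpha> \<longleftrightarrow>
     (\<forall>t. \<alpha> t \<in> linear_maps (pm_space P t) (pm_space Q (t + \<epsilon>))) \<and>
     (\<forall>t t'. t \<le> t' \<longrightarrow> (\<forall>x\<in>carrier (pm_space P t).
        \<alpha> t' (pm_map P t t' x) = pm_map Q (t + \<epsilon>) (t' + \<epsilon>) (\<alpha> t x)))"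

definition interleaved ::
    "real \<Rightarrow> ('f::field, 'v) persistence \<Rightarrow> ('f, 'w) persistence \<Rightarrow> bool" where
  "interleaved \<epsilon> P Q \<longleftrightarrow> (\<exists>\<alpha> \<beta>.
     shift_morphism \<epsilon> P Q \<alpha> \<and> shift_morphism \<epsilon> Q P \<beta> \<and>
     (\<forall>t. \<forall>x\<in>carrier (pm_space P t). \<beta> (t + \<epsilon>) (\<alpha> t x) = pm_map P t (t + 2 * \<epsilon>) x) \<and>
     (\<forall>t. \<forall>y\<in>carrier (pm_space Q t). \<alpha> (t + \<epsilon>) (\<beta> t y) = pm_map Q t (t + 2 * \<epsilon>) y))"

definition interleaving_distance ::
    "('f::field, 'v) persistence \<Rightarrow> ('f, 'w) persistence \<Rightarrow> ennreal" where
  "interleaving_distance P Q = (INF \<epsilon> \<in> {\<epsilon>. 0 < \<epsilon> \<and> interleaved \<epsilon> P Q}. ennreal \<epsilon>)"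


section \<open>Ordered tuple complexes and their homology\<close>

definition face :: "nat \<Rightarrow> 'a list \<Rightarrow> 'a list" where
  "face i v = take i v @ drop (Suc i) v"

definition ot_complex :: "'a list set \<Rightarrow> bool" where
  "ot_complex K \<longleftrightarrow> [] \<notin> K \<and> (\<forall>v\<in>K. 2 \<le> length v \<longrightarrow> (\<forall>i<length v. face i v \<in> K))"

definition ot_filtration :: "(real \<Rightarrow> 'a list set) \<Rightarrow> bool" where
  "ot_filtration K \<longleftrightarrow> (\<forall>t. ot_complex (K t)) \<and> (\<forall>t r. t \<le> r \<longrightarrow> K t \<subseteq> K r)"

text \<open>A chain is a finitely supported function on tuples. The fields \<open>mult\<close> and \<open>one\<close> are
  inherited from the record type of rings and are irrelevant for modules.\<close>

definition chain_module :: "'a list set \<Rightarrow> nat \<Rightarrow> ('f::field, 'a list \<Rightarrow>\<^sub>0 'f) module" where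
  "chain_module K p =
     \<lparr>carrier = {c. Poly_Mapping.keys c \<subseteq> {v \<in> K. length v = Suc p}},
      monoid.mult = undefined, one = undefined, zero = 0, add = (+),
      module.smult = (\<lambda>a. Poly_Mapping.map ((*) a))\<rparr>"

definition boundary :: "nat \<Rightarrow> ('a list \<Rightarrow>\<^sub>0 'f::field) \<Rightarrow> ('a list \<Rightarrow>\<^sub>0 'f)" where
  "boundary p c = (if p = 0 then 0 else
     (\<Sum>v\<in>Poly_Mapping.keys c. \<Sum>i\<le>p.
        Poly_Mapping.single (face i v) ((-1) ^ i * Poly_Mapping.lookup c v)))"

definition cycle_module :: "'a list set \<Rightarrow> nat \<Rightarrow> ('f::field, 'a list \<Rightarrow>\<^sub>0 'f) module" where
  "cycle_module K p =
     (chain_module K p)\<lparr>carrier := {c \<in> carrier (chain_module K p). boundary p c = 0}\<rparr>"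

definition boundaries :: "'a list set \<Rightarrow> nat \<Rightarrow> ('a list \<Rightarrow>\<^sub>0 'f::field) set" where
  "boundaries K p = boundary (Suc p) ` carrier (chain_module K (Suc p))"

text \<open>The quotient is formed from cosets as in the library's \<^const>\<open>FactRing\<close>. Scalar
  multiplication scales the representatives and adds \<open>B\<close> again, which matters for the scalar \<open>0\<close>.\<close>

definition quotient_module :: "('f::field, 'v) module \<Rightarrow> 'v set \<Rightarrow> ('f, 'v set) module" where
  "quotient_module V B =
     \<lparr>carrier = a_rcosets\<^bsub>V\<^esub> B,
      monoid.mult = undefined, one = undefined, zero = B, add = set_add V,
      module.smult = (\<lambda>a C. \<Union>x\<in>C. B +>\<^bsub>V\<^esub> (a \<odot>\<^bsub>V\<^esub> x))\<rparr>"

definition homology :: "'a list set \<Rightarrow> nat \<Rightarrow> ('f::field, ('a list \<Rightarrow>\<^sub>0 'f) set) module" where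
  "homology K k = quotient_module (cycle_module K k) (boundaries K k)"

text \<open>For \<open>K \<subseteq> L\<close>, the map on homology induced by the inclusion sends the class of a cycle in \<open>K\<close>
  to the class of the same cycle in \<open>L\<close>, which is the union of the classes in \<open>L\<close> of all its
  representatives.\<close>

definition inclusion_map ::
    "'a list set \<Rightarrow> nat \<Rightarrow> ('a list \<Rightarrow>\<^sub>0 'f::field) set \<Rightarrow> ('a list \<Rightarrow>\<^sub>0 'f) set" where
  "inclusion_map L k C = (\<Union>z\<in>C. boundaries L k +>\<^bsub>cycle_module L k\<^esub> z)"

definition ot_persistence ::
    "nat \<Rightarrow> (real \<Rightarrow> 'a list set) \<Rightarrow> ('f::field, ('a list \<Rightarrow>\<^sub>0 'f) set) persistence" where
  "ot_persistence k K =
     \<lparr>pm_space = (\<lambda>t. homology (K t) k), pm_map = (\<lambda>t s. inclusion_map (K s) k)\<rparr>"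


section \<open>The directed Rips filtration\<close>

definition directed_rips :: "'a set \<Rightarrow> ('a \<Rightarrow> 'a \<Rightarrow> real) \<Rightarrow> real \<Rightarrow> 'a list set" where
  "directed_rips X f t = {v. v \<noteq> [] \<and> set v \<subseteq> X \<and>
     (\<forall>j<length v. \<forall>i\<le>j. f (v ! i) (v ! j) \<le> t)}"

definition directed_rips_persistence ::
    "nat \<Rightarrow> 'a set \<Rightarrow> ('a \<Rightarrow> 'a \<Rightarrow> real) \<Rightarrow> ('f::field, ('a list \<Rightarrow>\<^sub>0 'f) set) persistence" where
  "directed_rips_persistence k X f = ot_persistence k (directed_rips X f)"


section \<open>Well-definedness\<close>

lemma length_face: "i < length v \<Longrightarrow> length (face i v) = length v - 1"
  by (simp add: face_def)

lemma nth_face: "i < length v \<Longrightarrow> n < length v - 1 \<Longrightarrow>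
    face i v ! n = v ! (if n < i then n else Suc n)"
  by (auto simp: face_def nth_append min_def)

lemma face_face:
  assumes "j < i" "i < length v"
  shows "face j (face i v) = face (i - 1) (face j v)"
proof (rule nth_equalityI)
  show "length (face j (face i v)) = length (face (i - 1) (face j v))"
    using assms by (simp add: length_face)
  fix n assume "n < length (face j (face i v))"
  then have n: "n < length v - 2" using assms by (simp add: length_face)
  have "face j (face i v) ! n = v ! (let m = (if n < j then n else Suc n) in if m < i then m else Suc m)"
    using n assms by (simp add: nth_face length_face Let_def)
  also have "\<dots> = v ! (let m = (if n < i - 1 then n else Suc n) in if m < j then m else Suc m)"
    using assms(1) by (intro arg_cong[of _ _ "(!) v"]) (auto simp: Let_def)
  also have "\<dots> = face (i - 1) (face j v) ! n"
    using n assms by (simp add: nth_face length_face Let_def)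
  finally show "face j (face i v) ! n = face (i - 1) (face j v) ! n" .
qed

lemma ot_filtration_directed_rips: "ot_filtration (directed_rips X f)"
  unfolding ot_filtration_def
proof (intro conjI allI impI)
  fix t show "ot_complex (directed_rips X f t)"
    unfolding ot_complex_def
  proof (intro conjI ballI impI allI)
    show "[] \<notin> directed_rips X f t" by (simp add: directed_rips_def)
  next
    fix v i
    assume v: "v \<in> directed_rips X f t" and l: "2 \<le> length v" and i: "i < length v"
    have "face i v \<noteq> []" using length_face[OF i] l by fastforce
    moreover have "set (face i v) \<subseteq> X"
      using v set_take_subset[of i v] set_drop_subset[of "Suc i" v]
      by (auto simp: face_def directed_rips_def)
    moreover have "f (face i v ! a) (face i v ! b) \<le> t" if "b < length (face i v)" "a \<le> b" for a b
    proof -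
      let ?s = "\<lambda>n. if n < i then n else Suc n"
      have "?s b < length v" "?s a \<le> ?s b" using that length_face[OF i] by auto
      then have "f (v ! ?s a) (v ! ?s b) \<le> t"
        using v unfolding directed_rips_def by blast
      then show ?thesis using that i by (simp add: nth_face length_face split del: if_split)
    qed
    ultimately show "face i v \<in> directed_rips X f t" by (auto simp: directed_rips_def)
  qed
next
  fix t r :: real assume "t \<le> r"
  then show "directed_rips X f t \<subseteq> directed_rips X f r"
    by (auto simp: directed_rips_def intro: order_trans)
qed

lemma lookup_map_times:
  "Poly_Mapping.lookup (Poly_Mapping.map ((*) a) c) v = (a :: 'f::field) * Poly_Mapping.lookup c v"
  by (simp add: map.rep_eq when_def)

lemma keys_map_times: "Poly_Mapping.keys (Poly_Mapping.map ((*) (a::'f::field)) c) \<subseteq> Poly_Mapping.keys c"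
  by (auto simp: in_keys_iff lookup_map_times)

lemma boundary_superset:
  assumes "finite A" "Poly_Mapping.keys c \<subseteq> A" "p > 0"
  shows "boundary p c = (\<Sum>v\<in>A. \<Sum>i\<le>p.
           Poly_Mapping.single (face i v) ((-1) ^ i * Poly_Mapping.lookup c v))"
proof -
  have "(\<Sum>v\<in>Poly_Mapping.keys c. \<Sum>i\<le>p.
           Poly_Mapping.single (face i v) ((-1) ^ i * Poly_Mapping.lookup c v)) =
        (\<Sum>v\<in>A. \<Sum>i\<le>p.
           Poly_Mapping.single (face i v) ((-1) ^ i * Poly_Mapping.lookup c v))"
    by (rule sum.mono_neutral_left) (use assms in \<open>auto simp: in_keys_iff\<close>)
  then show ?thesis using assms(3) by (simp add: boundary_def)
qed

lemma boundary_add: "boundary p (c + d) = boundary p c + boundary p d"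
proof (cases "p = 0")
  case False
  let ?A = "Poly_Mapping.keys c \<union> Poly_Mapping.keys d"
  have "boundary p e = (\<Sum>v\<in>?A. \<Sum>i\<le>p.
           Poly_Mapping.single (face i v) ((-1) ^ i * Poly_Mapping.lookup e v))"
    if "e \<in> {c, d, c + d}" for e
    by (rule boundary_superset) (use that False Poly_Mapping.keys_add[of c d] in auto)
  then show ?thesis
    by (simp add: lookup_add distrib_left single_add sum.distrib)
qed (simp add: boundary_def)

lemma boundary_zero: "boundary p 0 = 0"
  by (simp add: boundary_def)

lemma boundary_sum: "boundary p (sum g A) = (\<Sum>a\<in>A. boundary p (g a))"
  by (induction A rule: infinite_finite_induct) (simp_all add: boundary_zero boundary_add)

lemma boundary_single:
  "p > 0 \<Longrightarrow> boundary p (Poly_Mapping.single v a) =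
     (\<Sum>i\<le>p. Poly_Mapping.single (face i v) ((-1) ^ i * a))"
  by (subst boundary_superset[of "{v}"]) auto

lemma map_times_add:
  "Poly_Mapping.map ((*) a) (c + d) = Poly_Mapping.map ((*) a) c + Poly_Mapping.map ((*) (a::'f::field)) d"
  by (rule poly_mapping_eqI) (simp add: lookup_map_times lookup_add distrib_left)

lemma map_times_zero [simp]: "Poly_Mapping.map ((*) (a::'f::field)) 0 = 0"
  by (rule poly_mapping_eqI) (simp add: lookup_map_times)

lemma map_times_sum:
  "Poly_Mapping.map ((*) (a::'f::field)) (sum g A) = (\<Sum>x\<in>A. Poly_Mapping.map ((*) a) (g x))"
  by (induction A rule: infinite_finite_induct) (simp_all add: map_times_add)

lemma boundary_map_times:
  "boundary p (Poly_Mapping.map ((*) a) c) = Poly_Mapping.map ((*) a) (boundary p c)"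
proof (cases "p = 0")
  case False
  then have "boundary p (Poly_Mapping.map ((*) a) c) =
     (\<Sum>v\<in>Poly_Mapping.keys c. \<Sum>i\<le>p.
        Poly_Mapping.single (face i v) ((-1) ^ i * (a * Poly_Mapping.lookup c v)))"
    by (subst boundary_superset[OF _ keys_map_times]) (simp_all add: lookup_map_times)
  also have "\<dots> = Poly_Mapping.map ((*) a) (boundary p c)"
    using False by (simp add: boundary_def map_times_sum ac_simps)
  finally show ?thesis .
qed (simp add: boundary_def)

lemma boundary_boundary_single:
  assumes "length v = Suc (Suc p)"
  shows "boundary p (boundary (Suc p) (Poly_Mapping.single v (a::'f::field))) = 0"
proof (cases "p = 0")
  case False
  define T where "T i j = Poly_Mapping.single (face j (face i v)) ((-1) ^ j * ((-1) ^ i * a))"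
    for i j
  have "boundary p (boundary (Suc p) (Poly_Mapping.single v a)) = (\<Sum>i\<le>Suc p. \<Sum>j\<le>p. T i j)"
    using False by (simp add: boundary_single boundary_sum T_def del: sum.atMost_Suc)
  also have "\<dots> = (\<Sum>(i, j)\<in>{..Suc p} \<times> {..p}. T i j)"
    by (rule sum.cartesian_product)
  also have "\<dots> = (\<Sum>(i, j)\<in>{(i, j). j < i \<and> i \<le> Suc p}. T i j) +
                  (\<Sum>(i, j)\<in>{(i, j). i \<le> j \<and> j \<le> p}. T i j)"
    by (subst sum.union_disjoint[symmetric])
       (auto intro!: sum.cong intro: finite_subset[of _ "{..Suc p} \<times> {..Suc p}"])
  also have "(\<Sum>(i, j)\<in>{(i, j). j < i \<and> i \<le> Suc p}. T i j) =
             (\<Sum>(i, j)\<in>{(i, j). i \<le> j \<and> j \<le> p}. - T i j)"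
  proof (rule sum.reindex_bij_witness[of _ "\<lambda>(i, j). (Suc j, i)" "\<lambda>(i, j). (j, i - 1)"])
    fix x assume "x \<in> {(i, j). j < i \<and> i \<le> Suc p}"
    then obtain i j where x: "x = (i, j)" "j < i" "i \<le> Suc p" by auto
    then obtain n where n: "i = Suc n" by (cases i) auto
    have "face j (face (Suc n) v) = face n (face j v)"
      using face_face[of j i v] x n assms by simp
    then have "T (Suc n) j = - T j n"
      by (simp add: T_def flip: single_uminus) (simp add: ac_simps)
    then show "(case case x of (i, j) \<Rightarrow> (j, i - 1) of (i, j) \<Rightarrow> - T i j) = (case x of (i, j) \<Rightarrow> T i j)"
      by (simp add: x n)
  qed auto
  also have "\<dots> = - (\<Sum>(i, j)\<in>{(i, j). i \<le> j \<and> j \<le> p}. T i j)"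
    by (simp add: sum_negf case_prod_beta)
  finally show ?thesis by simp
qed (simp add: boundary_def)

lemma chain_sum_single:
  "c = (\<Sum>v\<in>Poly_Mapping.keys c. Poly_Mapping.single v (Poly_Mapping.lookup c v))"
  by (rule poly_mapping_eqI)
     (auto simp: lookup_sum lookup_single when_def in_keys_iff)

lemma boundary_boundary:
  assumes "c \<in> carrier (chain_module K (Suc p))"
  shows "boundary p (boundary (Suc p) c) = 0"
proof -
  have "boundary p (boundary (Suc p) c) = (\<Sum>v\<in>Poly_Mapping.keys c.
          boundary p (boundary (Suc p) (Poly_Mapping.single v (Poly_Mapping.lookup c v))))"
    by (subst chain_sum_single) (simp add: boundary_sum)
  also have "\<dots> = 0"
    by (rule sum.neutral) (use assms in \<open>auto simp: chain_module_def intro!: boundary_boundary_single\<close>)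
  finally show ?thesis .
qed

lemma boundary_in_chains:
  assumes K: "ot_complex K" and c: "c \<in> carrier (chain_module K (Suc p))"
  shows "boundary (Suc p) c \<in> carrier (chain_module K p)"
proof -
  have "Poly_Mapping.keys (Poly_Mapping.single (face i v) ((-1) ^ i * Poly_Mapping.lookup c v))
      \<subseteq> {v \<in> K. length v = Suc p}" if "v \<in> Poly_Mapping.keys c" "i \<le> Suc p" for v i
  proof -
    have v: "v \<in> K" "length v = Suc (Suc p)" using that c by (auto simp: chain_module_def)
    then have "face i v \<in> K" using K that unfolding ot_complex_def by auto
    then show ?thesis using v that by (simp add: length_face)
  qed
  note * = this
  have "w \<in> {v \<in> K. length v = Suc p}" if w: "w \<in> Poly_Mapping.keys (boundary (Suc p) c)" for w
  proof -
    let ?s = "\<lambda>v i. Poly_Mapping.single (face i v) ((-1) ^ i * Poly_Mapping.lookup c v)"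
    have "boundary (Suc p) c = (\<Sum>v\<in>Poly_Mapping.keys c. \<Sum>i\<le>Suc p. ?s v i)"
      by (simp add: boundary_def del: sum.atMost_Suc)
    with w obtain v where v: "v \<in> Poly_Mapping.keys c" "w \<in> Poly_Mapping.keys (\<Sum>i\<le>Suc p. ?s v i)"
      using Poly_Mapping.keys_sum[of "\<lambda>v. \<Sum>i\<le>Suc p. ?s v i" "Poly_Mapping.keys c"] by auto
    then obtain i where "i \<le> Suc p" "w \<in> Poly_Mapping.keys (?s v i)"
      using Poly_Mapping.keys_sum[of "?s v" "{..Suc p}"] by blast
    with *[OF v(1)] show ?thesis by blast
  qed
  then have "Poly_Mapping.keys (boundary (Suc p) c) \<subseteq> {v \<in> K. length v = Suc p}" by blast
  then show ?thesis by (simp add: chain_module_def)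
qed

lemma module_chain_module:
  "module ring_of_type_algebra (chain_module K p :: ('f::field, 'a list \<Rightarrow>\<^sub>0 'f) module)"
proof (rule moduleI)
  show "cring (ring_of_type_algebra :: 'f ring)" by (rule cring_from_type_algebra)
  show "abelian_group (chain_module K p :: ('f::field, 'a list \<Rightarrow>\<^sub>0 'f) module)"
  proof (rule abelian_groupI)
    fix x :: "'a list \<Rightarrow>\<^sub>0 'f" assume "x \<in> carrier (chain_module K p)"
    then show "\<exists>y\<in>carrier (chain_module K p). y \<oplus>\<^bsub>chain_module K p\<^esub> x = \<zero>\<^bsub>chain_module K p\<^esub>"
      by (intro bexI[of _ "- x"]) (auto simp: chain_module_def)
  qed (use Poly_Mapping.keys_add in \<open>fastforce simp: chain_module_def ac_simps\<close>)+
next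
  fix a b :: 'f and x y :: "'a list \<Rightarrow>\<^sub>0 'f"
  show "a \<odot>\<^bsub>chain_module K p\<^esub> x \<in> carrier (chain_module K p)" if "x \<in> carrier (chain_module K p)"
    using that keys_map_times[of a x] by (auto simp: chain_module_def)
qed (auto simp: chain_module_def ring_of_type_algebra_def lookup_map_times lookup_add algebra_simps
    intro!: poly_mapping_eqI)

lemma chain_module_a_inv:
  fixes x :: "'a list \<Rightarrow>\<^sub>0 'f::field"
  assumes "x \<in> carrier (chain_module K p)"
  shows "\<ominus>\<^bsub>chain_module K p\<^esub> x = - x"
proof -
  interpret module ring_of_type_algebra "chain_module K p :: ('f, 'a list \<Rightarrow>\<^sub>0 'f) module" by (rule module_chain_module)
  show ?thesis
    by (rule M.minus_equality) (use assms in \<open>auto simp: chain_module_def\<close>)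
qed

lemma boundary_uminus: "boundary p (- c) = - boundary p c"
  using boundary_add[of p c "- c"] by (simp add: boundary_zero eq_neg_iff_add_eq_0 add.commute)

lemma carrier_cycle_module:
  "carrier (cycle_module K p) = {c \<in> carrier (chain_module K p). boundary p c = 0}"
  and add_cycle_module [simp]: "add (cycle_module K p) = (+)"
  and zero_cycle_module [simp]: "zero (cycle_module K p) = 0"
  and smult_cycle_module [simp]: "module.smult (cycle_module K p) = (\<lambda>a. Poly_Mapping.map ((*) a))"
  by (simp_all add: cycle_module_def chain_module_def)

lemma module_cycle_module:
  "module ring_of_type_algebra (cycle_module K p :: ('f::field, 'a list \<Rightarrow>\<^sub>0 'f) module)"
proof -
  interpret module ring_of_type_algebra "chain_module K p :: ('f, 'a list \<Rightarrow>\<^sub>0 'f) module" by (rule module_chain_module)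
  have "submodule {c \<in> carrier (chain_module K p). boundary p c = 0}
          ring_of_type_algebra (chain_module K p :: ('f, 'a list \<Rightarrow>\<^sub>0 'f) module)"
  proof (rule submoduleI)
    fix a :: 'f and x :: "'a list \<Rightarrow>\<^sub>0 'f" assume "x \<in> {c \<in> carrier (chain_module K p). boundary p c = 0}"
    then show "a \<odot>\<^bsub>chain_module K p\<^esub> x \<in> {c \<in> carrier (chain_module K p). boundary p c = 0}"
      using smult_closed[of a x]
      by (auto simp: ring_of_type_algebra_def chain_module_def boundary_map_times)
  next
    fix x y :: "'a list \<Rightarrow>\<^sub>0 'f" assume "x \<in> {c \<in> carrier (chain_module K p). boundary p c = 0}"
      "y \<in> {c \<in> carrier (chain_module K p). boundary p c = 0}"
    then show "x \<oplus>\<^bsub>chain_module K p\<^esub> y \<in> {c \<in> carrier (chain_module K p). boundary p c = 0}"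
      using M.a_closed[of x y] by (auto simp: chain_module_def boundary_add)
  next
    fix x :: "'a list \<Rightarrow>\<^sub>0 'f" assume x: "x \<in> {c \<in> carrier (chain_module K p). boundary p c = 0}"
    then show "\<ominus>\<^bsub>chain_module K p\<^esub> x \<in> {c \<in> carrier (chain_module K p). boundary p c = 0}"
      using M.a_inv_closed[of x] by (simp add: chain_module_a_inv boundary_uminus)
  qed (auto simp: chain_module_def boundary_zero)
  then show ?thesis
    unfolding cycle_module_def
    by (rule submodule.submodule_is_module[OF _ module_chain_module])
qed

lemma cycle_module_a_inv:
  fixes x :: "'a list \<Rightarrow>\<^sub>0 'f::field"
  assumes "x \<in> carrier (cycle_module K p)"
  shows "\<ominus>\<^bsub>cycle_module K p\<^esub> x = - x"
proof -
  interpret module ring_of_type_algebra "cycle_module K p :: ('f, 'a list \<Rightarrow>\<^sub>0 'f) module" by (rule module_cycle_module)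
  show ?thesis
    by (rule M.minus_equality)
       (use assms in \<open>auto simp: carrier_cycle_module chain_module_def boundary_uminus\<close>)
qed

lemma boundaries_submodule:
  fixes K :: "'a list set"
  assumes "ot_complex K"
  shows "submodule (boundaries K p :: ('a list \<Rightarrow>\<^sub>0 'f::field) set) ring_of_type_algebra (cycle_module K p)"
proof -
  interpret C: module ring_of_type_algebra "chain_module K (Suc p) :: ('f, 'a list \<Rightarrow>\<^sub>0 'f) module" by (rule module_chain_module)
  interpret module ring_of_type_algebra "cycle_module K p :: ('f, 'a list \<Rightarrow>\<^sub>0 'f) module" by (rule module_cycle_module)
  have sub: "(boundaries K p :: ('a list \<Rightarrow>\<^sub>0 'f) set) \<subseteq> carrier (cycle_module K p)"
    using boundary_in_chains[OF assms] boundary_boundary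
    by (fastforce simp: boundaries_def carrier_cycle_module)
  show ?thesis
  proof (rule submoduleI[OF sub])
    show "\<zero>\<^bsub>cycle_module K p\<^esub> \<in> boundaries K p"
      using C.M.zero_closed
      by (auto simp: boundaries_def chain_module_def boundary_zero intro!: image_eqI[of _ _ 0])
  next
    fix x :: "'a list \<Rightarrow>\<^sub>0 'f" assume x: "x \<in> boundaries K p"
    then obtain c where "c \<in> carrier (chain_module K (Suc p))" "x = boundary (Suc p) c"
      by (auto simp: boundaries_def)
    then have "- x \<in> boundaries K p"
      using C.M.a_inv_closed[of c]
      by (auto simp: boundaries_def boundary_uminus chain_module_a_inv intro!: image_eqI[of _ _ "- c"])
    then show "\<ominus>\<^bsub>cycle_module K p\<^esub> x \<in> boundaries K p"
      using cycle_module_a_inv[OF subsetD[OF sub x]] by simp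
  next
    fix x y :: "'a list \<Rightarrow>\<^sub>0 'f" assume "x \<in> boundaries K p" "y \<in> boundaries K p"
    then obtain c d where "c \<in> carrier (chain_module K (Suc p))" "x = boundary (Suc p) c"
       "d \<in> carrier (chain_module K (Suc p))" "y = boundary (Suc p) d"
      by (auto simp: boundaries_def)
    then show "x \<oplus>\<^bsub>cycle_module K p\<^esub> y \<in> boundaries K p"
      using C.M.a_closed[of c d]
      by (auto simp: boundaries_def boundary_add chain_module_def intro!: image_eqI[of _ _ "c + d"])
  next
    fix a :: 'f and x :: "'a list \<Rightarrow>\<^sub>0 'f" assume "x \<in> boundaries K p"
    then obtain c where "c \<in> carrier (chain_module K (Suc p))" "x = boundary (Suc p) c"
      by (auto simp: boundaries_def)
    then show "a \<odot>\<^bsub>cycle_module K p\<^esub> x \<in> boundaries K p"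
      using C.smult_closed[of a c]
      by (auto simp: boundaries_def boundary_map_times chain_module_def ring_of_type_algebra_def
          intro!: image_eqI[of _ _ "Poly_Mapping.map ((*) a) c"])
  qed
qed

context
  fixes V :: "('f::field, 'v) module" and B :: "'v set"
  assumes V: "module ring_of_type_algebra V" and B: "submodule B ring_of_type_algebra V"
begin

interpretation module ring_of_type_algebra V by (rule V)
interpretation B: submodule B ring_of_type_algebra V by (rule B)

interpretation Q: abelian_subgroup B V
  by (rule abelian_subgroupI3)
     (simp_all add: additive_subgroup_def B.subgroup_axioms M.abelian_group_axioms)

lemma carrier_quotient_module:
  "carrier (quotient_module V B) = (\<lambda>x. B +>\<^bsub>V\<^esub> x) ` carrier V"
  by (auto simp: quotient_module_def A_RCOSETS_def')

lemma add_quotient_module: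
  "x \<in> carrier V \<Longrightarrow> y \<in> carrier V \<Longrightarrow>
    (B +>\<^bsub>V\<^esub> x) \<oplus>\<^bsub>quotient_module V B\<^esub> (B +>\<^bsub>V\<^esub> y) = B +>\<^bsub>V\<^esub> (x \<oplus>\<^bsub>V\<^esub> y)"
  by (simp add: quotient_module_def Q.a_rcos_sum)

lemma zero_quotient_module: "\<zero>\<^bsub>quotient_module V B\<^esub> = B +>\<^bsub>V\<^esub> \<zero>\<^bsub>V\<^esub>"
  using B.subset by (simp add: quotient_module_def M.a_coset_add_zero)

lemma coset_cong:
  assumes "x \<in> carrier V" "y \<in> B"
  shows "B +>\<^bsub>V\<^esub> (y \<oplus>\<^bsub>V\<^esub> x) = B +>\<^bsub>V\<^esub> x"
proof -
  have "y \<oplus>\<^bsub>V\<^esub> x \<in> B +>\<^bsub>V\<^esub> x" using assms by (auto simp: a_r_coset_def')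
  then show ?thesis using Q.a_repr_independence'[OF _ assms(1)] by simp
qed

lemma smult_quotient_module:
  assumes x: "x \<in> carrier V"
  shows "a \<odot>\<^bsub>quotient_module V B\<^esub> (B +>\<^bsub>V\<^esub> x) = B +>\<^bsub>V\<^esub> (a \<odot>\<^bsub>V\<^esub> x)"
proof -
  have a: "a \<in> carrier ring_of_type_algebra" by (simp add: ring_of_type_algebra_def)
  have "B +>\<^bsub>V\<^esub> (a \<odot>\<^bsub>V\<^esub> (y \<oplus>\<^bsub>V\<^esub> x)) = B +>\<^bsub>V\<^esub> (a \<odot>\<^bsub>V\<^esub> x)" if y: "y \<in> B" for y
    using a x y B.mem_carrier[OF y] by (simp add: smult_r_distr coset_cong)
  moreover have "B \<noteq> {}" using B.one_closed by blast
  ultimately show ?thesis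
    by (auto simp: quotient_module_def a_r_coset_def'[of V B x])
qed

lemma module_quotient_module: "module ring_of_type_algebra (quotient_module V B)"
proof (rule moduleI)
  show "cring (ring_of_type_algebra :: 'f ring)" by (rule cring_from_type_algebra)
  show "abelian_group (quotient_module V B)"
  proof (rule abelian_groupI)
    fix x assume "x \<in> carrier (quotient_module V B)"
    then obtain z where z: "z \<in> carrier V" "x = B +>\<^bsub>V\<^esub> z" by (auto simp: carrier_quotient_module)
    then show "\<exists>y\<in>carrier (quotient_module V B). y \<oplus>\<^bsub>quotient_module V B\<^esub> x = \<zero>\<^bsub>quotient_module V B\<^esub>"
      by (intro bexI[of _ "B +>\<^bsub>V\<^esub> (\<ominus>\<^bsub>V\<^esub> z)"])
         (auto simp: carrier_quotient_module add_quotient_module zero_quotient_module M.l_neg)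
  qed (auto simp: carrier_quotient_module add_quotient_module zero_quotient_module M.a_ac)
next
  fix a b :: 'f and x
  assume "a \<in> carrier ring_of_type_algebra" "b \<in> carrier ring_of_type_algebra" "x \<in> carrier (quotient_module V B)"
  then show "(a \<oplus>\<^bsub>ring_of_type_algebra\<^esub> b) \<odot>\<^bsub>quotient_module V B\<^esub> x = a \<odot>\<^bsub>quotient_module V B\<^esub> x \<oplus>\<^bsub>quotient_module V B\<^esub> b \<odot>\<^bsub>quotient_module V B\<^esub> x"
    by (clarsimp simp only: carrier_quotient_module) (simp add: add_quotient_module smult_quotient_module smult_l_distr)
next
  fix a :: 'f and x y
  assume "a \<in> carrier ring_of_type_algebra" "x \<in> carrier (quotient_module V B)" "y \<in> carrier (quotient_module V B)"
  then show "a \<odot>\<^bsub>quotient_module V B\<^esub> (x \<oplus>\<^bsub>quotient_module V B\<^esub> y) = a \<odot>\<^bsub>quotient_module V B\<^esub> x \<oplus>\<^bsub>quotient_module V B\<^esub> a \<odot>\<^bsub>quotient_module V B\<^esub> y"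
    by (clarsimp simp only: carrier_quotient_module) (simp add: add_quotient_module smult_quotient_module smult_r_distr)
next
  fix a b :: 'f and x
  assume "a \<in> carrier ring_of_type_algebra" "b \<in> carrier ring_of_type_algebra" "x \<in> carrier (quotient_module V B)"
  then show "(a \<otimes>\<^bsub>ring_of_type_algebra\<^esub> b) \<odot>\<^bsub>quotient_module V B\<^esub> x = a \<odot>\<^bsub>quotient_module V B\<^esub> (b \<odot>\<^bsub>quotient_module V B\<^esub> x)"
    by (clarsimp simp only: carrier_quotient_module) (simp add: smult_quotient_module smult_assoc1)
next
  fix a :: 'f and x
  assume "a \<in> carrier ring_of_type_algebra" "x \<in> carrier (quotient_module V B)"
  then show "a \<odot>\<^bsub>quotient_module V B\<^esub> x \<in> carrier (quotient_module V B)"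
    by (clarsimp simp only: carrier_quotient_module) (simp add: smult_quotient_module)
next
  fix x
  assume "x \<in> carrier (quotient_module V B)"
  then show "\<one>\<^bsub>ring_of_type_algebra\<^esub> \<odot>\<^bsub>quotient_module V B\<^esub> x = x"
    by (clarsimp simp only: carrier_quotient_module) (simp add: smult_quotient_module)
qed

end

lemma carrier_homology:
  assumes "ot_complex K"
  shows "carrier (homology K k) =
     (\<lambda>z. boundaries K k +>\<^bsub>cycle_module K k\<^esub> z) ` carrier (cycle_module K k)"
  unfolding homology_def
  by (rule carrier_quotient_module[OF module_cycle_module boundaries_submodule[OF assms]])

lemma module_homology: "ot_complex K \<Longrightarrow> module ring_of_type_algebra (homology K k)"
  unfolding homology_def
  by (rule module_quotient_module[OF module_cycle_module boundaries_submodule])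

lemma cycle_module_mono: "K \<subseteq> L \<Longrightarrow> carrier (cycle_module K k) \<subseteq> carrier (cycle_module L k)"
  by (auto simp: carrier_cycle_module chain_module_def)

lemma boundaries_mono: "K \<subseteq> L \<Longrightarrow> boundaries K k \<subseteq> boundaries L k"
  by (auto simp: boundaries_def chain_module_def)

lemma inclusion_map_class:
  fixes z :: "'a list \<Rightarrow>\<^sub>0 'f::field"
  assumes K: "ot_complex K" and L: "ot_complex L" and KL: "K \<subseteq> L"
    and z: "z \<in> carrier (cycle_module K k)"
  shows "inclusion_map L k (boundaries K k +>\<^bsub>cycle_module K k\<^esub> z) =
         boundaries L k +>\<^bsub>cycle_module L k\<^esub> z"
proof -
  note S = module_cycle_module[of L k] boundaries_submodule[OF L, of k]
  have "boundaries L k +>\<^bsub>cycle_module L k\<^esub> (y + z) = boundaries L k +>\<^bsub>cycle_module L k\<^esub> z"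
    if "y \<in> boundaries K k" for y
    using coset_cong[OF S, of z y] that z cycle_module_mono[OF KL] boundaries_mono[OF KL] by auto
  moreover have "0 \<in> boundaries K k"
    by (auto simp: boundaries_def chain_module_def boundary_zero intro!: image_eqI[of _ _ 0])
  ultimately show ?thesis
    by (auto simp: inclusion_map_def a_r_coset_def'[of "cycle_module K k"])
qed

lemma inclusion_map_linear:
  fixes K :: "'a list set"
  assumes K: "ot_complex K" and L: "ot_complex L" and KL: "K \<subseteq> L"
  shows "inclusion_map L k \<in> linear_maps (homology K k :: ('f::field, ('a list \<Rightarrow>\<^sub>0 'f) set) module) (homology L k)"
proof -
  note SK = module_cycle_module[of K k] boundaries_submodule[OF K, of k]
  note SL = module_cycle_module[of L k] boundaries_submodule[OF L, of k]
  interpret Z: module ring_of_type_algebra "cycle_module K k :: ('f, 'a list \<Rightarrow>\<^sub>0 'f) module" by (rule SK)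
  have mono: "z \<in> carrier (cycle_module L k)" if "z \<in> carrier (cycle_module K k)"
    for z :: "'a list \<Rightarrow>\<^sub>0 'f"
    using that cycle_module_mono[OF KL] by blast
  have "x + y \<in> carrier (cycle_module K k)"
    if "x \<in> carrier (cycle_module K k)" "y \<in> carrier (cycle_module K k)"
    for x y :: "'a list \<Rightarrow>\<^sub>0 'f"
    using Z.M.a_closed[OF that] by simp
  moreover have "Poly_Mapping.map ((*) a) x \<in> carrier (cycle_module K k)"
    if "x \<in> carrier (cycle_module K k)"
    for a and x :: "'a list \<Rightarrow>\<^sub>0 'f"
    using Z.smult_closed[OF _ that, of a] by (simp add: ring_of_type_algebra_def)
  ultimately show ?thesis
    unfolding linear_maps_def homology_def
    by (auto simp: carrier_quotient_module[OF SK] carrier_quotient_module[OF SL]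
        add_quotient_module[OF SK] add_quotient_module[OF SL]
        smult_quotient_module[OF SK] smult_quotient_module[OF SL]
        inclusion_map_class[OF K L KL] mono)
qed

lemma persistence_module_ot_persistence:
  fixes K :: "real \<Rightarrow> 'a list set"
  assumes "ot_filtration K"
  shows "persistence_module (ot_persistence k K :: ('f::field, ('a list \<Rightarrow>\<^sub>0 'f) set) persistence)"
proof -
  have K: "ot_complex (K t)" for t using assms by (simp add: ot_filtration_def)
  have mono: "t \<le> s \<Longrightarrow> K t \<subseteq> K s" for t s using assms by (simp add: ot_filtration_def)
  have zmono: "z \<in> carrier (cycle_module (K s) k)"
    if "t \<le> s" "z \<in> carrier (cycle_module (K t) k)"
    for t s and z :: "'a list \<Rightarrow>\<^sub>0 'f"
    using that cycle_module_mono[OF mono[OF that(1)]] by blast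
  show ?thesis
    unfolding persistence_module_def ot_persistence_def
    by (auto simp: module_homology[OF K] inclusion_map_linear[OF K K mono] carrier_homology[OF K]
        inclusion_map_class[OF K K mono] zmono order_trans)
qed

lemma persistence_module_directed_rips: "persistence_module (directed_rips_persistence k X f)"
  unfolding directed_rips_persistence_def
  by (rule persistence_module_ot_persistence[OF ot_filtration_directed_rips])

end

theory Submission
  imports Defs
begin

text \<open>
  Selecting partners in a correspondence of distortion at most \<open>\<epsilon>\<close> gives vertex maps \<open>\<phi>\<close> and \<open>\<psi>\<close>
  that carry the filtration at \<open>t\<close> into the other one at \<open>t + \<epsilon>\<close>. Since \<open>(x, \<phi> x)\<close> and
  \<open>(\<psi> (\<phi> x'), \<phi> x')\<close> are both in the correspondence, \<open>f x (\<psi> (\<phi> x')) \<le> g (\<phi> x) (\<phi> x') + \<epsilon>\<close>,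
  so every prism tuple \<open>(v\<^sub>0, \<dots>, v\<^sub>i, \<psi>\<phi> v\<^sub>i, \<dots>, \<psi>\<phi> v\<^sub>p)\<close> over a simplex at \<open>t\<close> exists at
  \<open>t + 2\<epsilon>\<close>. The prism operator is then a chain homotopy from the inclusion to \<open>\<psi>\<phi>\<close>.
\<close>

section \<open>Linear extension to chains\<close>

text \<open>\<open>push\<close>, \<open>cone\<close>, the augmented boundary and the prism operator
  all act on chains through this extension, so by \<open>lin_ext_lin_ext\<close> identities between
  them reduce to identities on single tuples.\<close>

definition lin_ext :: "('u \<Rightarrow> 'w \<Rightarrow>\<^sub>0 'f::field) \<Rightarrow> ('u \<Rightarrow>\<^sub>0 'f) \<Rightarrow> ('w \<Rightarrow>\<^sub>0 'f)" where
  "lin_ext F c = (\<Sum>v\<in>Poly_Mapping.keys c. Poly_Mapping.map ((*) (Poly_Mapping.lookup c v)) (F v))"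

lemma map_times_0 [simp]: "Poly_Mapping.map ((*) (0::'f::field)) c = 0"
  by (rule poly_mapping_eqI) (simp add: lookup_map_times)

lemma map_times_1 [simp]: "Poly_Mapping.map ((*) (1::'f::field)) c = c"
  by (rule poly_mapping_eqI) (simp add: lookup_map_times)

lemma map_times_plus:
  "Poly_Mapping.map ((*) (a + b :: 'f::field)) c = Poly_Mapping.map ((*) a) c + Poly_Mapping.map ((*) b) c"
  by (rule poly_mapping_eqI) (simp add: lookup_map_times lookup_add distrib_right)

lemma map_times_map_times:
  "Poly_Mapping.map ((*) a) (Poly_Mapping.map ((*) b) c) = Poly_Mapping.map ((*) (a * b :: 'f::field)) c"
  by (rule poly_mapping_eqI) (simp add: lookup_map_times ac_simps)

lemma map_times_diff:
  "Poly_Mapping.map ((*) (a::'f::field)) (c - d) = Poly_Mapping.map ((*) a) c - Poly_Mapping.map ((*) a) d"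
  by (rule poly_mapping_eqI) (simp add: lookup_map_times lookup_minus right_diff_distrib)

lemma map_times_single:
  "Poly_Mapping.map ((*) (a::'f::field)) (Poly_Mapping.single v b) = Poly_Mapping.single v (a * b)"
  by (rule poly_mapping_eqI) (simp add: lookup_map_times lookup_single when_def)

text \<open>Keys outside the support contribute zero, so chains with different supports can be
  summed over one common index set.\<close>

lemma lin_ext_superset:
  assumes "finite A" "Poly_Mapping.keys c \<subseteq> A"
  shows "lin_ext F c = (\<Sum>v\<in>A. Poly_Mapping.map ((*) (Poly_Mapping.lookup c v)) (F v))"
  unfolding lin_ext_def
  by (rule sum.mono_neutral_left) (use assms in \<open>auto simp: in_keys_iff\<close>)

lemma lin_ext_zero [simp]: "lin_ext F 0 = 0"
  by (simp add: lin_ext_def)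

lemma lin_ext_add: "lin_ext F (c + d) = lin_ext F c + lin_ext F d"
proof -
  let ?A = "Poly_Mapping.keys c \<union> Poly_Mapping.keys d"
  have "lin_ext F e = (\<Sum>v\<in>?A. Poly_Mapping.map ((*) (Poly_Mapping.lookup e v)) (F v))"
    if "e \<in> {c, d, c + d}" for e
    by (rule lin_ext_superset) (use that Poly_Mapping.keys_add[of c d] in auto)
  then show ?thesis by (simp add: lookup_add map_times_plus sum.distrib)
qed

lemma lin_ext_diff: "lin_ext F (c - d) = lin_ext F c - lin_ext F d"
  using lin_ext_add[of F "c - d" d] by simp

lemma lin_ext_sum: "lin_ext F (sum g A) = (\<Sum>a\<in>A. lin_ext F (g a))"
  by (induction A rule: infinite_finite_induct) (simp_all add: lin_ext_add)

lemma lin_ext_map_times: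
  "lin_ext F (Poly_Mapping.map ((*) a) c) = Poly_Mapping.map ((*) a) (lin_ext F c)"
  by (subst lin_ext_superset[OF _ keys_map_times])
     (simp_all add: lin_ext_def lookup_map_times map_times_sum map_times_map_times)

lemma lin_ext_single: "lin_ext F (Poly_Mapping.single v a) = Poly_Mapping.map ((*) a) (F v)"
  by (subst lin_ext_superset[of "{v}"]) simp_all

lemma lin_ext_lin_ext: "lin_ext F (lin_ext G c) = lin_ext (\<lambda>v. lin_ext F (G v)) c"
  by (simp add: lin_ext_def[of G] lin_ext_def[of "\<lambda>v. lin_ext F (G v)"] lin_ext_sum lin_ext_map_times)

lemma lin_ext_fun_diff: "lin_ext (\<lambda>v. F v - G v) c = lin_ext F c - lin_ext G c"
  by (simp add: lin_ext_def map_times_diff sum_subtractf)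

lemma lin_ext_id: "lin_ext (\<lambda>v. Poly_Mapping.single v 1) c = c"
  using chain_sum_single[of c] by (simp add: lin_ext_def map_times_single)

lemma lin_ext_cong:
  "(\<And>v. v \<in> Poly_Mapping.keys c \<Longrightarrow> F v = G v) \<Longrightarrow> lin_ext F c = lin_ext G c"
  by (simp add: lin_ext_def)

lemma lin_ext_const_0 [simp]: "lin_ext (\<lambda>v. 0) c = 0"
  by (simp add: lin_ext_def)

lemma keys_lin_ext:
  "Poly_Mapping.keys (lin_ext F c) \<subseteq> (\<Union>v\<in>Poly_Mapping.keys c. Poly_Mapping.keys (F v))"
proof -
  have "Poly_Mapping.keys (lin_ext F c) \<subseteq> (\<Union>v\<in>Poly_Mapping.keys c.
          Poly_Mapping.keys (Poly_Mapping.map ((*) (Poly_Mapping.lookup c v)) (F v)))"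
    unfolding lin_ext_def by (rule Poly_Mapping.keys_sum)
  then show ?thesis using keys_map_times by fastforce
qed


section \<open>Chain maps and the prism operator\<close>

text \<open>Tuples may have repeated entries, so even a non-injective \<open>\<phi>\<close> sends
  tuples to tuples of the same length, and no degenerate images have to be set to zero.\<close>

abbreviation push :: "('a \<Rightarrow> 'b) \<Rightarrow> ('a list \<Rightarrow>\<^sub>0 'f::field) \<Rightarrow> ('b list \<Rightarrow>\<^sub>0 'f)" where
  "push \<phi> \<equiv> lin_ext (\<lambda>v. Poly_Mapping.single (map \<phi> v) 1)"

abbreviation cone :: "'a \<Rightarrow> ('a list \<Rightarrow>\<^sub>0 'f::field) \<Rightarrow> ('a list \<Rightarrow>\<^sub>0 'f)" where
  "cone a \<equiv> lin_ext (\<lambda>v. Poly_Mapping.single (a # v) 1)"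

text \<open>The boundary of the augmented complex: a vertex has boundary \<open>[]\<close>, unlike for \<^const>\<open>boundary\<close>.
  This removes the case distinction in degree \<open>0\<close> from the inductions over tuples.\<close>

fun aug_boundary :: "'a list \<Rightarrow> ('a list \<Rightarrow>\<^sub>0 'f::field)" where
  "aug_boundary [] = 0"
| "aug_boundary (a # v) = Poly_Mapping.single v 1 - cone a (aug_boundary v)"

text \<open>\<open>prism \<chi> (v\<^sub>0, \<dots>, v\<^sub>p)\<close> is the alternating sum of the tuples
  \<open>(v\<^sub>0, \<dots>, v\<^sub>i, \<chi> v\<^sub>i, \<dots>, \<chi> v\<^sub>p)\<close>.\<close>

fun prism :: "('a \<Rightarrow> 'a) \<Rightarrow> 'a list \<Rightarrow> ('a list \<Rightarrow>\<^sub>0 'f::field)" where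
  "prism \<chi> [] = 0"
| "prism \<chi> (a # v) = Poly_Mapping.single (a # map \<chi> (a # v)) 1 - cone a (prism \<chi> v)"

section \<open>Boundary, cone, push and prism on the augmented complex\<close>

lemma aug_boundary_eq_sum:
  "aug_boundary v = (\<Sum>i<length v. Poly_Mapping.single (face i v) ((-1) ^ i))"
proof (induction v)
  case (Cons a v)
  \<comment> \<open>The faces of \<open>a # v\<close> that keep \<open>a\<close> are the faces of
    \<open>v\<close> with \<open>a\<close> in front. Their index is one higher, which accounts for
    the minus sign in \<open>aug_boundary\<close>.\<close>
  have "cone a (aug_boundary v :: 'a list \<Rightarrow>\<^sub>0 'b) =
      (\<Sum>i<length v. Poly_Mapping.single (face (Suc i) (a # v)) ((-1) ^ i))"
    by (simp add: Cons.IH lin_ext_sum lin_ext_single map_times_single face_def)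
  moreover have "face 0 (a # v) = v" by (simp add: face_def)
  ultimately show ?case
    by (simp add: sum.lessThan_Suc_shift single_uminus sum_negf del: sum.lessThan_Suc)
qed simp

text \<open>In positive degree all faces are nonempty and the augmentation is invisible. In degree 0
  the two boundaries differ on vertices.\<close>

lemma boundary_eq_lin_ext:
  assumes "c \<in> carrier (chain_module K p)" "p > 0"
  shows "boundary p c = lin_ext aug_boundary c"
  using assms
  by (auto simp: boundary_def lin_ext_def chain_module_def aug_boundary_eq_sum map_times_sum
      map_times_single lessThan_Suc_atMost ac_simps intro!: sum.cong)

text \<open>Coning is a contracting homotopy of the augmented complex:
  \<open>\<partial> cone + cone \<partial> = id\<close>.\<close>

lemma aug_boundary_cone: "lin_ext aug_boundary (cone a c) = c - cone a (lin_ext aug_boundary c)"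
  by (simp add: lin_ext_lin_ext lin_ext_single lin_ext_fun_diff lin_ext_id)

lemma push_cone: "push \<phi> (cone a c) = cone (\<phi> a) (push \<phi> c)"
  by (simp add: lin_ext_lin_ext lin_ext_single)

lemma prism_cone:
  "lin_ext (prism \<chi>) (cone a c) = cone a (cone (\<chi> a) (push \<chi> c)) - cone a (lin_ext (prism \<chi>) c)"
  by (simp add: lin_ext_lin_ext lin_ext_single lin_ext_fun_diff)

lemma push_push: "push \<psi> (push \<phi> c) = push (\<psi> \<circ> \<phi>) c"
  by (simp add: lin_ext_lin_ext lin_ext_single)

lemma aug_boundary_map: "aug_boundary (map \<phi> v) = push \<phi> (aug_boundary v)"
  by (induction v) (simp_all add: lin_ext_diff lin_ext_single push_cone)

lemma aug_boundary_push: "lin_ext aug_boundary (push \<phi> c) = push \<phi> (lin_ext aug_boundary c)"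
  by (simp add: lin_ext_lin_ext lin_ext_single aug_boundary_map)

text \<open>Induction on the tuple: coning the hypothesis yields \<open>cone a\<close> of
  \<open>map \<chi> v\<close>, which cancels against a term from the boundary of the leading tuple
  \<open>a # map \<chi> (a # v)\<close>. What remains is the classical formula
  \<open>\<partial>P + P\<partial> = \<chi> - id\<close>.\<close>

lemma aug_boundary_prism:
  "lin_ext aug_boundary (prism \<chi> v) =
     Poly_Mapping.single (map \<chi> v) 1 - Poly_Mapping.single v 1 - lin_ext (prism \<chi>) (aug_boundary v)"
proof (induction v)
  case (Cons a v)
  then show ?case
    by (simp add: lin_ext_diff lin_ext_single aug_boundary_cone prism_cone aug_boundary_map)
qed simp

lemma prism_homotopy:
  "lin_ext aug_boundary (lin_ext (prism \<chi>) c) =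
     push \<chi> c - c - lin_ext (prism \<chi>) (lin_ext aug_boundary c)"
  by (simp add: lin_ext_lin_ext aug_boundary_prism lin_ext_fun_diff lin_ext_id)

text \<open>These are the tuples that a target complex has to contain. Neighbouring ones coincide
  with opposite signs if \<open>v ! Suc i = \<chi> (v ! i)\<close>, so cancellation can make the
  inclusion strict.\<close>

lemma keys_prism:
  "Poly_Mapping.keys (prism \<chi> v :: _ \<Rightarrow>\<^sub>0 'f::field) \<subseteq>
     (\<lambda>i. take (Suc i) v @ map \<chi> (drop i v)) ` {..<length v}"
proof (induction v)
  case (Cons a v)
  let ?T = "\<lambda>v i. take (Suc i) v @ map \<chi> (drop i v)"
  have "Poly_Mapping.keys (cone a (prism \<chi> v :: _ \<Rightarrow>\<^sub>0 'f)) \<subseteq> (#) a ` ?T v ` {..<length v}"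
    using keys_lin_ext[of "\<lambda>v. Poly_Mapping.single (a # v) (1::'f)" "prism \<chi> v"]
    by (intro order_trans[OF _ image_mono[OF Cons.IH]]) auto
  moreover have "Poly_Mapping.keys (prism \<chi> (a # v) :: _ \<Rightarrow>\<^sub>0 'f) \<subseteq>
      insert (?T (a # v) 0) (Poly_Mapping.keys (cone a (prism \<chi> v :: _ \<Rightarrow>\<^sub>0 'f)))"
    using Poly_Mapping.keys_diff[of "Poly_Mapping.single (?T (a # v) 0) (1::'f)" "cone a (prism \<chi> v)"]
    by simp
  \<comment> \<open>Putting \<open>a\<close> in front of the tuple split at \<open>i\<close> gives
    the longer tuple split at \<open>Suc i\<close>.\<close>
  moreover have "(#) a ` ?T v ` {..<length v} \<subseteq> ?T (a # v) ` {..<length (a # v)}"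
    by (auto intro!: image_eqI[of _ _ "Suc _"])
  moreover have "?T (a # v) 0 \<in> ?T (a # v) ` {..<length (a # v)}"
    by (rule imageI) simp
  ultimately show ?case by blast
qed simp

section \<open>Effect of push and prism on chains, cycles and boundaries\<close>

lemma push_in_chains:
  assumes "c \<in> carrier (chain_module K p)" "map \<phi> ` K \<subseteq> L"
  shows "push \<phi> c \<in> carrier (chain_module L p)"
proof -
  have "Poly_Mapping.keys (push \<phi> c) \<subseteq> map \<phi> ` Poly_Mapping.keys c"
    using keys_lin_ext[of "\<lambda>v. Poly_Mapping.single (map \<phi> v) 1" c] by (rule order_trans) auto
  moreover have "map \<phi> ` Poly_Mapping.keys c \<subseteq> {v \<in> L. length v = Suc p}"
    using assms by (auto simp: chain_module_def)
  ultimately show ?thesis by (simp add: chain_module_def)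
qed

lemma boundary_push:
  assumes "c \<in> carrier (chain_module K p)"
  shows "boundary p (push \<phi> c) = push \<phi> (boundary p c)"
proof (cases "p = 0")
  case False
  \<comment> \<open>The image of \<open>K\<close> under \<open>map \<phi>\<close> is taken as the
    target, so the identity holds for every \<open>\<phi>\<close>.\<close>
  then show ?thesis
    using boundary_eq_lin_ext[OF assms] boundary_eq_lin_ext[OF push_in_chains[OF assms subset_refl]]
    by (simp add: aug_boundary_push)
qed (simp add: boundary_def)

lemma push_in_cycles:
  assumes "z \<in> carrier (cycle_module K p)" "map \<phi> ` K \<subseteq> L"
  shows "push \<phi> z \<in> carrier (cycle_module L p)"
  using assms by (auto simp: carrier_cycle_module push_in_chains boundary_push)

lemma push_in_boundaries:
  assumes "y \<in> boundaries K p" "map \<phi> ` K \<subseteq> L"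
  shows "push \<phi> y \<in> boundaries L p"
proof -
  obtain c where c: "c \<in> carrier (chain_module K (Suc p))" "y = boundary (Suc p) c"
    using assms(1) by (auto simp: boundaries_def)
  then have "push \<phi> y = boundary (Suc p) (push \<phi> c)" by (simp add: boundary_push)
  then show ?thesis using push_in_chains[OF c(1) assms(2)] by (auto simp: boundaries_def)
qed

text \<open>The prism chain of \<open>z\<close> lies in \<open>L\<close> by the second hypothesis.
  Applied to a cycle, \<open>\<partial>P + P\<partial>\<close> leaves only
  \<open>\<partial>P\<close>, so this chain bounds the difference.\<close>

lemma push_diff_in_boundaries:
  fixes z :: "'a list \<Rightarrow>\<^sub>0 'f::field"
  assumes z: "z \<in> carrier (cycle_module K k)"
    and prism: "\<And>v i. v \<in> K \<Longrightarrow> i < length v \<Longrightarrow> take (Suc i) v @ map \<chi> (drop i v) \<in> L"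
  shows "push \<chi> z - z \<in> boundaries L k"
proof -
  have zc: "z \<in> carrier (chain_module K k)" and z0: "boundary k z = 0"
    using z by (auto simp: carrier_cycle_module)
  have "w \<in> L \<and> length w = Suc (Suc k)"
    if w: "w \<in> Poly_Mapping.keys (lin_ext (prism \<chi>) z)" for w
  proof -
    obtain v where v: "v \<in> Poly_Mapping.keys z" "w \<in> Poly_Mapping.keys (prism \<chi> v :: _ \<Rightarrow>\<^sub>0 'f)"
      using w keys_lin_ext[of "prism \<chi>" z] by blast
    then obtain i where i: "i < length v" "w = take (Suc i) v @ map \<chi> (drop i v)"
      using keys_prism[of \<chi> v] by blast
    have "v \<in> K" "length v = Suc k" using v(1) zc by (auto simp: chain_module_def)
    then show ?thesis using prism[of v i] i by simp
  qed
  then have h: "lin_ext (prism \<chi>) z \<in> carrier (chain_module L (Suc k))"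
    by (auto simp: chain_module_def)
  \<comment> \<open>In degree 0 every chain is a cycle, and its augmented boundary may be a nonzero
    multiple of \<open>[]\<close>; the value \<open>prism \<chi> [] = 0\<close> removes it.\<close>
  have "lin_ext (prism \<chi>) (lin_ext aug_boundary z) = 0"
  proof (cases "k = 0")
    case True
    then have "lin_ext (prism \<chi>) (aug_boundary v) = 0" if "v \<in> Poly_Mapping.keys z" for v
      using that zc by (cases v) (auto simp: chain_module_def lin_ext_single)
    then have "lin_ext (\<lambda>v. lin_ext (prism \<chi>) (aug_boundary v)) z = lin_ext (\<lambda>v. 0 :: _ \<Rightarrow>\<^sub>0 'f) z"
      by (rule lin_ext_cong)
    then show ?thesis by (simp add: lin_ext_lin_ext)
  next
    case False
    then show ?thesis using boundary_eq_lin_ext[OF zc] z0 by simp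
  qed
  then have "boundary (Suc k) (lin_ext (prism \<chi>) z) = push \<chi> z - z"
    using boundary_eq_lin_ext[OF h] by (simp add: prism_homotopy)
  then show ?thesis using h by (metis boundaries_def imageI)
qed


section \<open>Induced maps on homology\<close>

abbreviation homology_class ::
    "'a list set \<Rightarrow> nat \<Rightarrow> ('a list \<Rightarrow>\<^sub>0 'f::field) \<Rightarrow> ('a list \<Rightarrow>\<^sub>0 'f) set" where
  "homology_class K k z \<equiv> boundaries K k +>\<^bsub>cycle_module K k\<^esub> z"

text \<open>As in \<open>inclusion_map\<close>, the union over all representatives avoids choosing
  one.\<close>

definition induced_map ::
    "('a \<Rightarrow> 'b) \<Rightarrow> 'b list set \<Rightarrow> nat \<Rightarrow> ('a list \<Rightarrow>\<^sub>0 'f::field) set \<Rightarrow> ('b list \<Rightarrow>\<^sub>0 'f) set" where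
  "induced_map \<phi> L k C = (\<Union>z\<in>C. homology_class L k (push \<phi> z))"

lemma homology_class_eqI:
  assumes L: "ot_complex L" and z: "z \<in> carrier (cycle_module L k)" and d: "w - z \<in> boundaries L k"
  shows "homology_class L k w = homology_class L k z"
  using coset_cong[OF module_cycle_module[of L k] boundaries_submodule[OF L, of k] z d] by simp

text \<open>Representatives of a class differ by boundaries, which \<open>push\<close> sends to
  boundaries, so the union consists of copies of a single class.\<close>

lemma induced_map_class:
  assumes L: "ot_complex L" and KL: "map \<phi> ` K \<subseteq> L" and z: "z \<in> carrier (cycle_module K k)"
  shows "induced_map \<phi> L k (homology_class K k z) = homology_class L k (push \<phi> z)"
proof -
  have "homology_class L k (push \<phi> (y + z)) = homology_class L k (push \<phi> z)"
    if "y \<in> boundaries K k" for y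
    using push_in_boundaries[OF that KL]
    by (intro homology_class_eqI[OF L push_in_cycles[OF z KL]]) (simp add: lin_ext_add)
  \<comment> \<open>The boundaries are nonempty, so the union of equal classes is that class and not
    the empty set.\<close>
  moreover have "0 \<in> boundaries K k"
    by (auto simp: boundaries_def chain_module_def boundary_zero intro!: image_eqI[of _ _ 0])
  ultimately show ?thesis
    by (auto simp: induced_map_def a_r_coset_def'[of "cycle_module K k"])
qed

lemma induced_map_linear:
  fixes K :: "'a list set" and L :: "'b list set"
  assumes K: "ot_complex K" and L: "ot_complex L" and KL: "map \<phi> ` K \<subseteq> L"
  shows "induced_map \<phi> L k \<in>
    linear_maps (homology K k :: ('f::field, ('a list \<Rightarrow>\<^sub>0 'f) set) module) (homology L k)"
proof -
  note SK = module_cycle_module[of K k] boundaries_submodule[OF K, of k]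
  note SL = module_cycle_module[of L k] boundaries_submodule[OF L, of k]
  interpret Z: module ring_of_type_algebra "cycle_module K k :: ('f, 'a list \<Rightarrow>\<^sub>0 'f) module" by (rule SK)
  have "x + y \<in> carrier (cycle_module K k)"
    if "x \<in> carrier (cycle_module K k)" "y \<in> carrier (cycle_module K k)"
    for x y :: "'a list \<Rightarrow>\<^sub>0 'f"
    using Z.M.a_closed[OF that] by simp
  moreover have "Poly_Mapping.map ((*) a) x \<in> carrier (cycle_module K k)"
    if "x \<in> carrier (cycle_module K k)"
    for a and x :: "'a list \<Rightarrow>\<^sub>0 'f"
    using Z.smult_closed[OF _ that, of a] by (simp add: ring_of_type_algebra_def)
  ultimately show ?thesis
    unfolding linear_maps_def homology_def
    by (auto simp: carrier_quotient_module[OF SK] carrier_quotient_module[OF SL]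
        add_quotient_module[OF SK] add_quotient_module[OF SL]
        smult_quotient_module[OF SK] smult_quotient_module[OF SL]
        induced_map_class[OF L KL] push_in_cycles[OF _ KL] lin_ext_add lin_ext_map_times)
qed


section \<open>Interleavings\<close>

text \<open>Naturality is checked on a representing cycle \<open>z\<close>: both composites yield
  the class of \<open>push \<phi> z\<close> at the later index.\<close>

lemma shift_morphism_induced:
  fixes K :: "real \<Rightarrow> 'a list set" and L :: "real \<Rightarrow> 'b list set"
  assumes K: "ot_filtration K" and L: "ot_filtration L"
    and \<phi>: "\<And>t. map \<phi> ` K t \<subseteq> L (t + \<epsilon>)"
  shows "shift_morphism \<epsilon> (ot_persistence k K :: ('f::field, ('a list \<Rightarrow>\<^sub>0 'f) set) persistence)
    (ot_persistence k L) (\<lambda>t. induced_map \<phi> (L (t + \<epsilon>)) k)"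
proof -
  have K': "ot_complex (K t)" and L': "ot_complex (L t)" for t
    using K L by (simp_all add: ot_filtration_def)
  have K_mono: "K t \<subseteq> K s" and L_mono: "L t \<subseteq> L s" if "t \<le> s" for t s
    using K L that by (simp_all add: ot_filtration_def)
  have "induced_map \<phi> (L (s + \<epsilon>)) k (inclusion_map (K s) k C) =
        inclusion_map (L (s + \<epsilon>)) k (induced_map \<phi> (L (t + \<epsilon>)) k C)"
    if ts: "t \<le> s" and C: "C \<in> carrier (homology (K t) k)"
    for t s and C :: "('a list \<Rightarrow>\<^sub>0 'f) set"
  proof -
    obtain z where z: "z \<in> carrier (cycle_module (K t) k)" "C = homology_class (K t) k z"
      using C by (auto simp: carrier_homology[OF K'])
    have zs: "z \<in> carrier (cycle_module (K s) k)"
      using z(1) cycle_module_mono[OF K_mono[OF ts]] by blast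
    have ts': "L (t + \<epsilon>) \<subseteq> L (s + \<epsilon>)" using ts by (simp add: L_mono)
    show ?thesis
      by (simp add: z(2) inclusion_map_class[OF K' K' K_mono[OF ts] z(1)]
          induced_map_class[OF L' \<phi> z(1)] induced_map_class[OF L' \<phi> zs]
          inclusion_map_class[OF L' L' ts' push_in_cycles[OF z(1) \<phi>]])
  qed
  then show ?thesis
    by (simp add: shift_morphism_def ot_persistence_def induced_map_linear[OF K' L' \<phi>])
qed

text \<open>On a cycle \<open>z\<close> the two sides are the classes of
  \<open>push (\<psi> \<circ> \<phi>) z\<close> and of \<open>z\<close>, whose difference bounds in
  \<open>N\<close> because \<open>N\<close> contains the prism tuples.\<close>

lemma induced_map_comp:
  assumes K: "ot_complex K" and L: "ot_complex L" and N: "ot_complex N"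
    and KN: "K \<subseteq> N" and \<phi>: "map \<phi> ` K \<subseteq> L" and \<psi>: "map \<psi> ` L \<subseteq> N"
    and prism: "\<And>v i. v \<in> K \<Longrightarrow> i < length v \<Longrightarrow> take (Suc i) v @ map (\<psi> \<circ> \<phi>) (drop i v) \<in> N"
    and C: "C \<in> carrier (homology K k)"
  shows "induced_map \<psi> N k (induced_map \<phi> L k C) = inclusion_map N k C"
proof -
  obtain z where z: "z \<in> carrier (cycle_module K k)" "C = homology_class K k z"
    using C by (auto simp: carrier_homology[OF K])
  have zN: "z \<in> carrier (cycle_module N k)" using z(1) cycle_module_mono[OF KN] by blast
  have "homology_class N k (push (\<psi> \<circ> \<phi>) z) = homology_class N k z"
    by (rule homology_class_eqI[OF N zN push_diff_in_boundaries[OF z(1) prism]])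
  then show ?thesis
    by (simp add: z(2) induced_map_class[OF L \<phi> z(1)] inclusion_map_class[OF K N KN z(1)]
        induced_map_class[OF N \<psi> push_in_cycles[OF z(1) \<phi>]] push_push)
qed

lemma interleaved_ot_persistence:
  fixes K :: "real \<Rightarrow> 'a list set" and L :: "real \<Rightarrow> 'b list set"
  assumes K: "ot_filtration K" and L: "ot_filtration L" and \<epsilon>: "\<epsilon> \<ge> 0"
    and \<phi>: "\<And>t. map \<phi> ` K t \<subseteq> L (t + \<epsilon>)" and \<psi>: "\<And>t. map \<psi> ` L t \<subseteq> K (t + \<epsilon>)"
    and prism_K: "\<And>t v i. v \<in> K t \<Longrightarrow> i < length v \<Longrightarrow>
      take (Suc i) v @ map (\<psi> \<circ> \<phi>) (drop i v) \<in> K (t + 2 * \<epsilon>)"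
    and prism_L: "\<And>t v i. v \<in> L t \<Longrightarrow> i < length v \<Longrightarrow>
      take (Suc i) v @ map (\<phi> \<circ> \<psi>) (drop i v) \<in> L (t + 2 * \<epsilon>)"
  shows "interleaved \<epsilon> (ot_persistence k K :: ('f::field, ('a list \<Rightarrow>\<^sub>0 'f) set) persistence)
    (ot_persistence k L)"
proof -
  have K': "ot_complex (K t)" and L': "ot_complex (L t)"
    and KK: "K t \<subseteq> K (t + 2 * \<epsilon>)" and LL: "L t \<subseteq> L (t + 2 * \<epsilon>)" for t
    using K L \<epsilon> by (simp_all add: ot_filtration_def)
  \<comment> \<open>Composing two shifts ends at \<open>t + \<epsilon> + \<epsilon>\<close>, whereas
    the interleaving condition is stated at \<open>t + 2 * \<epsilon>\<close>.\<close>
  have \<epsilon>2: "t + \<epsilon> + \<epsilon> = t + 2 * \<epsilon>" for t by simp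
  have \<psi>': "map \<psi> ` L (t + \<epsilon>) \<subseteq> K (t + 2 * \<epsilon>)" and \<phi>': "map \<phi> ` K (t + \<epsilon>) \<subseteq> L (t + 2 * \<epsilon>)" for t
    using \<psi>[of "t + \<epsilon>"] \<phi>[of "t + \<epsilon>"] unfolding \<epsilon>2 by blast+
  show ?thesis
    unfolding interleaved_def
  proof (intro exI conjI allI ballI)
    show "shift_morphism \<epsilon> (ot_persistence k K) (ot_persistence k L)
        (\<lambda>t. induced_map \<phi> (L (t + \<epsilon>)) k)"
      by (rule shift_morphism_induced[OF K L \<phi>])
    show "shift_morphism \<epsilon> (ot_persistence k L) (ot_persistence k K)
        (\<lambda>t. induced_map \<psi> (K (t + \<epsilon>)) k)"
      by (rule shift_morphism_induced[OF L K \<psi>])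
  qed (simp_all add: ot_persistence_def \<epsilon>2
      induced_map_comp[OF K' L' K' KK \<phi> \<psi>' prism_K]
      induced_map_comp[OF L' K' L' LL \<psi> \<phi>' prism_L])
qed

section \<open>Vertex maps and prisms in the directed Rips filtration\<close>

lemma map_in_directed_rips:
  assumes "v \<in> directed_rips X f t" "\<And>x. x \<in> X \<Longrightarrow> \<phi> x \<in> Y"
    and "\<And>x x'. x \<in> X \<Longrightarrow> x' \<in> X \<Longrightarrow> g (\<phi> x) (\<phi> x') \<le> f x x' + \<epsilon>"
  shows "map \<phi> v \<in> directed_rips Y g (t + \<epsilon>)"
proof -
  have "g (\<phi> (v ! i)) (\<phi> (v ! j)) \<le> t + \<epsilon>" if "j < length v" "i \<le> j" for i j
  proof -
    have "v ! i \<in> X" "v ! j \<in> X" "f (v ! i) (v ! j) \<le> t"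
      using assms(1) that by (auto simp: directed_rips_def subset_iff)
    then show ?thesis using assms(3)[of "v ! i" "v ! j"] by linarith
  qed
  then show ?thesis using assms(1,2) by (auto simp: directed_rips_def)
qed

text \<open>Original vertices precede the \<open>\<chi>\<close>-images, so the ordered pairs are
  \<open>(x, x')\<close>, \<open>(x, \<chi> x')\<close> and \<open>(\<chi> x, \<chi> x')\<close>. A
  pair \<open>(\<chi> x, x')\<close> never has to be bounded, which matters as \<open>f\<close> may
  be asymmetric.\<close>

lemma prism_in_directed_rips:
  assumes v: "v \<in> directed_rips X f t" and i: "i < length v" and ts: "t \<le> s"
    and \<chi>: "\<And>x. x \<in> X \<Longrightarrow> \<chi> x \<in> X"
    and one: "\<And>x x'. x \<in> X \<Longrightarrow> x' \<in> X \<Longrightarrow> f x x' \<le> t \<Longrightarrow> f x (\<chi> x') \<le> s"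
    and two: "\<And>x x'. x \<in> X \<Longrightarrow> x' \<in> X \<Longrightarrow> f x x' \<le> t \<Longrightarrow> f (\<chi> x) (\<chi> x') \<le> s"
  shows "take (Suc i) v @ map \<chi> (drop i v) \<in> directed_rips X f s"
proof -
  let ?w = "take (Suc i) v @ map \<chi> (drop i v)"
  \<comment> \<open>Vertex \<open>i\<close> occurs twice, at position \<open>i\<close> as itself and
    at \<open>Suc i\<close> as its image; from there on the indices lag by one.\<close>
  have w: "?w ! n = (if n \<le> i then v ! n else \<chi> (v ! (n - 1)))" if "n < Suc (length v)" for n
  proof -
    have "length (take (Suc i) v) = Suc i" using i by simp
    then show ?thesis using i that by (auto simp: nth_append simp del: length_take)
  qed
  have l: "length ?w = Suc (length v)" using i by simp
  have "f (?w ! a) (?w ! b) \<le> s" if "b < length ?w" "a \<le> b" for a b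
  proof -
    \<comment> \<open>\<open>r\<close> maps positions of the prism tuple to those of
      \<open>v\<close> and is monotone. It sends \<open>i\<close> and \<open>Suc i\<close> both to
      \<open>i\<close>, and this is where the diagonal bound on \<open>f (v ! i) (v ! i)\<close>
      enters.\<close>
    define r where "r n = (if n \<le> i then n else n - 1)" for n
    have "r a \<le> r b" "r b < length v" using that i unfolding l by (auto simp: r_def)
    then have *: "v ! r a \<in> X" "v ! r b \<in> X" "f (v ! r a) (v ! r b) \<le> t"
      using v by (auto simp: directed_rips_def subset_iff)
    show ?thesis
      using * one[OF *] two[OF *] ts that w[of a] w[of b] unfolding l
      by (auto simp: r_def split: if_splits)
  qed
  moreover have "set ?w \<subseteq> X"
  proof -
    have "x \<in> X" if "x \<in> set v" for x using v that by (auto simp: directed_rips_def)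
    then show ?thesis using \<chi> by (auto dest!: in_set_takeD in_set_dropD)
  qed
  moreover have "?w \<noteq> []" using l by (metis Zero_not_Suc list.size(3))
  ultimately show ?thesis unfolding directed_rips_def by blast
qed

lemma interleaved_directed_rips:
  fixes X :: "'a set" and Y :: "'b set"
  assumes M: "correspondence X Y M" and \<epsilon>: "\<epsilon> \<ge> 0"
    and dis: "\<And>x y x' y'. (x, y) \<in> M \<Longrightarrow> (x', y') \<in> M \<Longrightarrow> \<bar>f x x' - g y y'\<bar> \<le> \<epsilon>"
  shows "interleaved \<epsilon>
    (directed_rips_persistence k X f :: ('f::field, ('a list \<Rightarrow>\<^sub>0 'f) set) persistence)
    (directed_rips_persistence k Y g)"
proof -
  obtain \<phi> where \<phi>: "\<And>x. x \<in> X \<Longrightarrow> (x, \<phi> x) \<in> M"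
    using M unfolding correspondence_def by metis
  obtain \<psi> where \<psi>: "\<And>y. y \<in> Y \<Longrightarrow> (\<psi> y, y) \<in> M"
    using M unfolding correspondence_def by metis
  have X: "x \<in> X" and Y: "y \<in> Y" if "(x, y) \<in> M" for x y
    using M that by (auto simp: correspondence_def)
  have dis1: "f x x' \<le> g y y' + \<epsilon>" and dis2: "g y y' \<le> f x x' + \<epsilon>"
    if "(x, y) \<in> M" "(x', y') \<in> M" for x y x' y'
    using dis[OF that] by linarith+
  \<comment> \<open>Passing from \<open>f\<close> to \<open>g\<close> along
    \<open>(x, \<phi> x)\<close> and \<open>(x', \<phi> x')\<close> costs \<open>\<epsilon>\<close>.
    Returning to \<open>f\<close> along other pairs of \<open>M\<close> with the same second entries
    costs \<open>\<epsilon>\<close> again.\<close>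
  have f1: "f x (\<psi> (\<phi> x')) \<le> t + 2 * \<epsilon>" and f2: "f (\<psi> (\<phi> x)) (\<psi> (\<phi> x')) \<le> t + 2 * \<epsilon>"
    if "x \<in> X" "x' \<in> X" "f x x' \<le> t" for x x' t
    using that dis2[OF \<phi>[OF that(1)] \<phi>[OF that(2)]]
      dis1[OF \<phi>[OF that(1)] \<psi>[OF Y[OF \<phi>[OF that(2)]]]]
      dis1[OF \<psi>[OF Y[OF \<phi>[OF that(1)]]] \<psi>[OF Y[OF \<phi>[OF that(2)]]]] by linarith+
  have g1: "g y (\<phi> (\<psi> y')) \<le> t + 2 * \<epsilon>" and g2: "g (\<phi> (\<psi> y)) (\<phi> (\<psi> y')) \<le> t + 2 * \<epsilon>"
    if "y \<in> Y" "y' \<in> Y" "g y y' \<le> t" for y y' t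
    using that dis1[OF \<psi>[OF that(1)] \<psi>[OF that(2)]]
      dis2[OF \<psi>[OF that(1)] \<phi>[OF X[OF \<psi>[OF that(2)]]]]
      dis2[OF \<phi>[OF X[OF \<psi>[OF that(1)]]] \<phi>[OF X[OF \<psi>[OF that(2)]]]] by linarith+
  show ?thesis
    unfolding directed_rips_persistence_def
  proof (rule interleaved_ot_persistence[where \<phi> = \<phi> and \<psi> = \<psi>,
        OF ot_filtration_directed_rips ot_filtration_directed_rips \<epsilon>])
    show "map \<phi> ` directed_rips X f t \<subseteq> directed_rips Y g (t + \<epsilon>)" for t
      by (auto intro!: map_in_directed_rips \<phi> dis2 intro: Y[OF \<phi>])
    show "map \<psi> ` directed_rips Y g t \<subseteq> directed_rips X f (t + \<epsilon>)" for t
      by (auto intro!: map_in_directed_rips \<psi> dis1 intro: X[OF \<psi>])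
  next
    fix t v i assume "v \<in> directed_rips X f t" "i < length v"
    then show "take (Suc i) v @ map (\<psi> \<circ> \<phi>) (drop i v) \<in> directed_rips X f (t + 2 * \<epsilon>)"
      by (rule prism_in_directed_rips) (use \<epsilon> f1 f2 X[OF \<psi>[OF Y[OF \<phi>]]] in auto)
  next
    fix t v i assume "v \<in> directed_rips Y g t" "i < length v"
    then show "take (Suc i) v @ map (\<phi> \<circ> \<psi>) (drop i v) \<in> directed_rips Y g (t + 2 * \<epsilon>)"
      by (rule prism_in_directed_rips) (use \<epsilon> g1 g2 Y[OF \<phi>[OF X[OF \<psi>]]] in auto)
  qed
qed

theorem theorem21:
  fixes X :: "'a set" and f :: "'a \<Rightarrow> 'a \<Rightarrow> real"
    and Y :: "'b set" and g :: "'b \<Rightarrow> 'b \<Rightarrow> real"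
    and k :: nat
    and PX :: "('f::field, ('a list \<Rightarrow>\<^sub>0 'f) set) persistence"
    and PY :: "('f, ('b list \<Rightarrow>\<^sub>0 'f) set) persistence"
  assumes "correspondence_distance X f Y g < \<infinity>"
    and "PX = directed_rips_persistence k X f"
    and "PY = directed_rips_persistence k Y g"
  shows "interleaving_distance PX PY \<le> 2 * correspondence_distance X f Y g"
proof -
  have "interleaving_distance PX PY \<le> distortion f g M" if M: "correspondence X Y M" for M
  proof (rule ennreal_le_epsilon)
    \<comment> \<open>The slack \<open>e\<close> is needed because
      \<open>interleaving_distance\<close> ranges over strictly positive parameters, while the
      distortion can be 0.\<close>
    fix e :: real assume e: "0 < e" and fin: "distortion f g M < top_class.top"
    define d where "d = enn2real (distortion f g M)"
    have d: "distortion f g M = ennreal d" "d \<ge> 0"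
      using fin by (simp_all add: d_def)
    have "\<bar>f x x' - g y y'\<bar> \<le> d + e" if "(x, y) \<in> M" "(x', y') \<in> M" for x y x' y'
    proof -
      have "ennreal \<bar>f x x' - g y y'\<bar> \<le> distortion f g M"
        unfolding distortion_def by (rule SUP_upper2[of "((x, y), (x', y'))"]) (use that in auto)
      then show ?thesis using d e by simp
    qed
    then have "interleaved (d + e) PX PY"
      unfolding assms(2,3) using d e by (intro interleaved_directed_rips[OF M]) auto
    then have "interleaving_distance PX PY \<le> ennreal (d + e)"
      unfolding interleaving_distance_def using d e by (intro INF_lower) auto
    then show "interleaving_distance PX PY \<le> distortion f g M + ennreal e"
      using d e by simp
  qed
  then have "interleaving_distance PX PY \<le> (INF M \<in> {M. correspondence X Y M}. distortion f g M)"
    by (intro INF_greatest) simp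
  \<comment> \<open>The factor 2 cancels the halving in
    \<open>correspondence_distance\<close>.\<close>
  then show ?thesis
    by (simp add: correspondence_distance_def ennreal_times_divide mult.commute[of 2] ennreal_mult_divide_eq)
qed

end
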